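(* Let $n\ge 1$ and let $G=(G_1,\dots,G_n)$ be i.i.d. random variables with values in $\mathbb{I}$ and $\mathbb{P}(G_j=i)=p_i$ for $i\in\mathbb{I}$. For any $k_1,\dots,k_r\ge 1$, any primitive words $\mathbf{i}_1\in Q_{k_1},\dots,\mathbf{i}_r\in Q_{k_r}$ that are pairwise non-conjugate, and any integers $l_1,\dots,l_r\ge 0$, $$\mathbb{P}\left(D_{\mathbf{i}_1}\ge l_1,\dots,D_{\mathbf{i}_r}\ge l_r\right)=\begin{cases} p_{\mathbf{i}_1}^{l_1}\cdots p_{\mathbf{i}_r}^{l_r} & \text{if } k_1l_1+\dots+k_rl_r\le n,\\ 0 & \text{otherwise.}\end{cases}$$
   Context: $\mathbb{I}\subset\mathbb{R}$ is a countable set. For $g=(g_1,\dots,g_n)\in\mathbb{R}^n$, the standardized permutation $\sigma=\mathrm{std}(g)\in\mathfrak{S}_n$ is the permutation defined by: $\sigma(j)<\sigma(k)$ if and only if $g_j<g_k$, or $g_j=g_k$ and $j<k$. A word $\mathbf{i}=(i_1,\dots,i_k)\in\mathbb{I}^k$ is a (nontrivial) power if $\mathbf{i}=y^l$ (concatenation of $l$ copies of $y$) for some word $y$ and integer $l\ge2$; it is primitive if it is not a power. $Q_k$ is the set of primitive words of length $k$ over $\mathbb{I}$. Two words are conjugate if one is a cyclic shift of the other. Write $p_{\mathbf{i}}=p_{i_1}\cdots p_{i_k}$. For $\mathbf{i}=(i_1,\dots,i_k)\in Q_k$, $D_{\mathbf{i}}=D_{\mathbf{i}}(G)$ is the number of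 cycles of length $k$ of $\mathrm{std}(G)$ that can be written $(x_1,\dots,x_k)$ (meaning $x_1\mapsto x_2\mapsto\cdots\mapsto x_k\mapsto x_1$) with $G_{x_1}=i_1,\dots,G_{x_k}=i_k$. *)

theory Defs
  imports "HOL-Probability.Probability" "HOL-Combinatorics.Permutations"
begin

text \<open>A vector $(g_1,\dots,g_n)$ is a function on \<open>nat\<close>, of which only the values on \<open>{1..n}\<close>
  matter; a word is a list.\<close>

definition is_std :: "nat \<Rightarrow> (nat \<Rightarrow> real) \<Rightarrow> (nat \<Rightarrow> nat) \<Rightarrow> bool" where
  "is_std n g \<sigma> \<longleftrightarrow> \<sigma> permutes {1..n} \<and>
     (\<forall>j\<in>{1..n}. \<forall>k\<in>{1..n}. \<sigma> j < \<sigma> k \<longleftrightarrow> g j < g k \<or> (g j = g k \<and> j < k))"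

definition std :: "nat \<Rightarrow> (nat \<Rightarrow> real) \<Rightarrow> nat \<Rightarrow> nat" where
  "std n g = (THE \<sigma>. is_std n g \<sigma>)"

definition is_power :: "'a list \<Rightarrow> bool" where
  "is_power w \<longleftrightarrow> (\<exists>y l. l \<ge> 2 \<and> w = concat (replicate l y))"

text \<open>The empty word is a power of itself, so it is not primitive.\<close>

definition primitive_words :: "'a set \<Rightarrow> nat \<Rightarrow> 'a list set" where
  "primitive_words I k = {w. length w = k \<and> set w \<subseteq> I \<and> \<not> is_power w}"

definition conjugate :: "'a list \<Rightarrow> 'a list \<Rightarrow> bool" where
  "conjugate v w \<longleftrightarrow> (\<exists>m. v = rotate m w)"

text \<open>\<open>xs = [x\<^sub>1, \<dots>, x\<^sub>k]\<close> is a way of writing a cycle of \<open>\<sigma>\<close> on \<open>{1..n}\<close>; the last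
  conjunct says that \<open>\<sigma>\<close> maps each \<open>x\<^sub>j\<close> to \<open>x\<^sub>j\<^sub>+\<^sub>1\<close>, and \<open>x\<^sub>k\<close> to \<open>x\<^sub>1\<close>.\<close>

definition writes_cycle :: "nat \<Rightarrow> (nat \<Rightarrow> nat) \<Rightarrow> nat list \<Rightarrow> bool" where
  "writes_cycle n \<sigma> xs \<longleftrightarrow>
     xs \<noteq> [] \<and> distinct xs \<and> set xs \<subseteq> {1..n} \<and> map \<sigma> xs = rotate1 xs"

text \<open>Cycles are counted rather than their ways of being written: a cycle of a given permutation is
  determined by its set of elements, so it is represented by that set. The length of the cycle
  is the length of \<open>w\<close>.\<close>

definition cycle_count :: "nat \<Rightarrow> 'a list \<Rightarrow> (nat \<Rightarrow> 'a) \<Rightarrow> (nat \<Rightarrow> nat) \<Rightarrow> nat" where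
  "cycle_count n w g \<sigma> = card {set xs | xs. writes_cycle n \<sigma> xs \<and> map g xs = w}"

definition D :: "nat \<Rightarrow> real list \<Rightarrow> (nat \<Rightarrow> real) \<Rightarrow> nat" where
  "D n w g = cycle_count n w g (std n g)"

definition word_weight :: "('a \<Rightarrow> real) \<Rightarrow> 'a list \<Rightarrow> real" where
  "word_weight p w = prod_list (map p w)"

lemma is_std_exists: "\<exists>\<sigma>. is_std n g \<sigma>"
proof -
  define R where "R j k \<longleftrightarrow> g j < g k \<or> (g j = g k \<and> j < k)" for j k :: nat
  define f where "f j = card {k\<in>{1..n}. R k j \<or> k = j}" for j
  define \<sigma> where "\<sigma> j = (if j \<in> {1..n} then f j else j)" for j
  have less: "f j < f k" if "R j k" "j \<in> {1..n}" "k \<in> {1..n}" for j k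
  proof -
    have "{i\<in>{1..n}. R i j \<or> i = j} \<subseteq> {i\<in>{1..n}. R i k \<or> i = k}"
      using \<open>R j k\<close> unfolding R_def by fastforce
    moreover have "k \<in> {i\<in>{1..n}. R i k \<or> i = k}" "k \<notin> {i\<in>{1..n}. R i j \<or> i = j}"
      using that unfolding R_def by auto
    ultimately have "{i\<in>{1..n}. R i j \<or> i = j} \<subset> {i\<in>{1..n}. R i k \<or> i = k}"
      by blast
    then show ?thesis
      unfolding f_def by (rule psubset_card_mono[rotated]) simp
  qed
  have tot: "R j k \<or> j = k \<or> R k j" for j k by (auto simp: R_def)
  have eq: "f j < f k \<longleftrightarrow> R j k" if "j \<in> {1..n}" "k \<in> {1..n}" for j k
  proof
    assume "f j < f k"
    then have "\<not> R k j" "j \<noteq> k" using less[OF _ that(2,1)] by auto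
    then show "R j k" using tot by blast
  qed (rule less[OF _ that])
  have inj: "inj_on f {1..n}"
  proof (rule inj_onI)
    fix j k assume "j \<in> {1..n}" "k \<in> {1..n}" "f j = f k"
    then have "\<not> R j k" "\<not> R k j" using less[of j k] less[of k j] by auto
    then show "j = k" using tot by blast
  qed
  have "f ` {1..n} \<subseteq> {1..n}"
  proof
    fix y assume "y \<in> f ` {1..n}"
    then obtain j where j: "j \<in> {1..n}" "y = f j" by auto
    have "f j > 0" unfolding f_def using j by (subst card_gt_0_iff) auto
    moreover have "f j \<le> card {1..n}" unfolding f_def by (rule card_mono) auto
    ultimately show "y \<in> {1..n}" using j by auto
  qed
  then have "bij_betw f {1..n} {1..n}"
    using inj by (simp add: bij_betw_def endo_inj_surj)
  then have "bij_betw \<sigma> {1..n} {1..n}"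
    by (subst bij_betw_cong[of _ _ f]) (auto simp: \<sigma>_def)
  then have "\<sigma> permutes {1..n}"
    by (rule bij_imp_permutes) (auto simp: \<sigma>_def)
  then show ?thesis
    using eq unfolding is_std_def R_def by (intro exI[of _ \<sigma>]) (simp add: \<sigma>_def)
qed

lemma is_std_unique:
  assumes "is_std n g \<sigma>" "is_std n g \<tau>"
  shows "\<sigma> = \<tau>"
proof
  fix j
  have rank: "\<rho> j = card {k\<in>{1..n}. \<not> (g j < g k \<or> (g j = g k \<and> j < k))}"
    if \<rho>: "is_std n g \<rho>" and j: "j \<in> {1..n}" for \<rho>
  proof -
    have p: "\<rho> permutes {1..n}" using \<rho> by (simp add: is_std_def)
    have le: "\<rho> j \<le> n" using permutes_in_image[OF p, of j] j by simp
    have "\<rho> j < \<rho> k \<longleftrightarrow> g j < g k \<or> (g j = g k \<and> j < k)" if "k \<in> {1..n}" for k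
      using \<rho> j that unfolding is_std_def by blast
    then have eq: "{k\<in>{1..n}. \<not> (g j < g k \<or> (g j = g k \<and> j < k))} = {k\<in>{1..n}. \<not> \<rho> j < \<rho> k}"
      by blast
    have "\<rho> ` {k\<in>{1..n}. \<not> \<rho> j < \<rho> k} = {y \<in> \<rho> ` {1..n}. \<not> \<rho> j < y}"
      by blast
    also have "\<dots> = {1..\<rho> j}"
      unfolding permutes_image[OF p] using le by auto
    finally have "card (\<rho> ` {k\<in>{1..n}. \<not> \<rho> j < \<rho> k}) = \<rho> j"
      by simp
    then show ?thesis
      unfolding eq by (simp add: card_image[OF permutes_inj_on[OF p]])
  qed
  show "\<sigma> j = \<tau> j"
  proof (cases "j \<in> {1..n}")
    case True
    then show ?thesis using rank[OF assms(1)] rank[OF assms(2)] by simp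
  next
    case False
    have p: "\<sigma> permutes {1..n}" "\<tau> permutes {1..n}"
      using assms by (simp_all add: is_std_def)
    show ?thesis
      unfolding permutes_not_in[OF p(1) False] permutes_not_in[OF p(2) False] ..
  qed
qed

lemma is_std_std: "is_std n g (std n g)"
proof -
  obtain \<sigma> where \<sigma>: "is_std n g \<sigma>" using is_std_exists by blast
  show ?thesis
    unfolding std_def by (rule theI[where P = "is_std n g", OF \<sigma>]) (rule is_std_unique[OF _ \<sigma>])
qed

end

theory Submission
  imports Defs "HOL-Library.Fun_Lexorder"
begin

text \<open>This is the Gessel--Reutenauer correspondence. With \<open>\<sigma> = std g\<close>, attach to each position \<open>x\<close>
  its past, the sequence of the values of \<open>g\<close> at \<open>x\<close>, \<open>\<sigma>\<inverse> x\<close>, \<open>\<sigma>\<inverse> (\<sigma>\<inverse> x)\<close> and so on. After dropping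
  first letters, the pasts of \<open>1, \<dots>, n\<close> increase lexicographically, so they can be recovered from
  their multiset, and \<open>g\<close> is read off their first letters. The multisets that occur are exactly those
  of size \<open>n\<close> that are invariant under the shift, and \<open>D n w g\<close> is the multiplicity of the periodic
  sequence spelled by \<open>w\<close> backwards. The event thus says that the multiset contains \<open>l a\<close> copies of the
  shift orbit of each \<open>w a\<close>. Subtracting these is a bijection onto the invariant multisets of the
  remaining size, whose weights sum to \<open>1\<close>, and it divides every weight by the product of the
  \<open>word_weight p (w a) ^ l a\<close>.\<close>

section \<open>Lexicographic order on sequences\<close>

definition tail_from :: "nat \<Rightarrow> (nat \<Rightarrow> 'a) \<Rightarrow> nat \<Rightarrow> 'a" where
  "tail_from j u = (\<lambda>m. u (m + j))"

lemma tail_from_0 [simp]: "tail_from 0 u = u"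
  by (simp add: tail_from_def)

lemma tail_from_tail_from [simp]: "tail_from i (tail_from j u) = tail_from (i + j) u"
  by (simp add: tail_from_def add.assoc)

lemma tail_from_apply [simp]: "tail_from j u m = u (m + j)"
  by (simp add: tail_from_def)

lemma less_fun_total: "less_fun u v \<or> u = v \<or> less_fun v u"
  for u v :: "nat \<Rightarrow> 'b::linorder"
proof (cases "u = v")
  case False
  then have ex: "\<exists>m. u m \<noteq> v m" by auto
  define m where "m = (LEAST m. u m \<noteq> v m)"
  have "u m \<noteq> v m" "\<And>i. i < m \<Longrightarrow> u i = v i"
    using LeastI_ex[OF ex] not_less_Least unfolding m_def by blast+
  then show ?thesis
    unfolding less_fun_def by (metis linorder_neq_iff)
qed simp

text \<open>Makes the sorting theory of linear orders applicable to sequences, whose type class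
  order is the pointwise one and not the lexicographic one.\<close>

lemma linorder_less_fun:
  "class.linorder (\<lambda>u v :: nat \<Rightarrow> 'b::linorder. less_fun u v \<or> u = v) less_fun"
proof -
  interpret order "\<lambda>u v :: nat \<Rightarrow> 'b::linorder. less_fun u v \<or> u = v" less_fun
    by (rule order_less_fun)
  show ?thesis
    by unfold_locales (use less_fun_total in blast)
qed

lemma lex_sorted_unique:
  fixes xs ys :: "(nat \<Rightarrow> 'b::linorder) list"
  assumes "sorted_wrt (\<lambda>u v. less_fun u v \<or> u = v) xs"
    and "sorted_wrt (\<lambda>u v. less_fun u v \<or> u = v) ys" and "mset xs = mset ys"
  shows "xs = ys"
  using linorder.properties_for_sort[OF linorder_less_fun assms(3,1)]
    linorder.properties_for_sort[OF linorder_less_fun refl assms(2)] by simp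

lemma lex_sort_exists:
  fixes f :: "'a \<Rightarrow> nat \<Rightarrow> 'b::linorder"
  obtains ys where "mset ys = M" "sorted_wrt (\<lambda>u v. less_fun u v \<or> u = v) (map f ys)"
proof -
  let ?le = "\<lambda>u v :: nat \<Rightarrow> 'b. less_fun u v \<or> u = v"
  obtain xs where xs: "mset xs = M" by (metis ex_mset)
  show ?thesis
  proof (rule that)
    show "mset (linorder.sort_key ?le f xs) = M"
      by (simp only: linorder.mset_sort[OF linorder_less_fun] xs)
    show "sorted_wrt ?le (map f (linorder.sort_key ?le f xs))"
      by (rule linorder.sorted_sort_key[OF linorder_less_fun])
  qed
qed

lemma sorted_wrt_map_upt:
  assumes "\<And>x y. x \<in> {1..n} \<Longrightarrow> y \<in> {1..n} \<Longrightarrow> x < y \<Longrightarrow> P (f x) (f y)"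
  shows "sorted_wrt P (map f [1..<Suc n])"
  by (auto simp: sorted_wrt_map sorted_wrt_iff_nth_less intro!: assms simp del: upt_Suc)

lemma mset_map_upt: "mset (map f [1..<Suc n]) = image_mset f (mset_set {1..n})"
  by (simp add: atLeastLessThanSuc_atLeastAtMost del: upt_Suc)

section \<open>Words and shift-invariant multisets\<close>

definition std_inv :: "nat \<Rightarrow> (nat \<Rightarrow> real) \<Rightarrow> nat \<Rightarrow> nat" where
  "std_inv n g = inv (std n g)"

definition past :: "nat \<Rightarrow> (nat \<Rightarrow> real) \<Rightarrow> nat \<Rightarrow> nat \<Rightarrow> real" where
  "past n g x = (\<lambda>m. g ((std_inv n g ^^ m) x))"

definition pasts :: "nat \<Rightarrow> (nat \<Rightarrow> real) \<Rightarrow> (nat \<Rightarrow> real) multiset" where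
  "pasts n g = image_mset (past n g) (mset_set {1..n})"

lemma std_permutes: "std n g permutes {1..n}"
  using is_std_std[of n g] by (simp add: is_std_def)

lemma std_inv_permutes: "std_inv n g permutes {1..n}"
  unfolding std_inv_def by (rule permutes_inv[OF std_permutes])

lemma std_inv_in: "std_inv n g x \<in> {1..n} \<longleftrightarrow> x \<in> {1..n}"
  by (rule permutes_in_image[OF std_inv_permutes])

lemma funpow_std_inv_in: "x \<in> {1..n} \<Longrightarrow> (std_inv n g ^^ m) x \<in> {1..n}"
  by (induction m) (simp_all only: funpow.simps comp_apply id_apply std_inv_in)

lemma std_of_std_inv [simp]: "std n g (std_inv n g x) = x"
  unfolding std_inv_def by (rule permutes_inverses(1)[OF std_permutes])

lemma std_inv_of_std [simp]: "std_inv n g (std n g x) = x"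
  unfolding std_inv_def by (rule permutes_inverses(2)[OF std_permutes])

text \<open>This is why sequences run backward: the order of two positions is decided by the letters
  at their preimages, and a tie is passed on to the preimages themselves, so the comparison can be
  unrolled step by step.\<close>

lemma less_iff_std_inv:
  assumes "x \<in> {1..n}" "y \<in> {1..n}"
  shows "x < y \<longleftrightarrow> g (std_inv n g x) < g (std_inv n g y) \<or>
    (g (std_inv n g x) = g (std_inv n g y) \<and> std_inv n g x < std_inv n g y)"
proof -
  have "std_inv n g x \<in> {1..n}" "std_inv n g y \<in> {1..n}" using assms by (simp_all only: std_inv_in)
  then have "std n g (std_inv n g x) < std n g (std_inv n g y) \<longleftrightarrow> g (std_inv n g x) < g (std_inv n g y) \<or>
    (g (std_inv n g x) = g (std_inv n g y) \<and> std_inv n g x < std_inv n g y)"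
    using is_std_std[of n g] unfolding is_std_def by blast
  then show ?thesis by simp
qed

lemma past_0 [simp]: "past n g x 0 = g x"
  by (simp add: past_def)

lemma past_Suc: "past n g x (Suc m) = past n g (std_inv n g x) m"
  by (simp add: past_def funpow_swap1)

lemma tail_from_past: "tail_from j (past n g x) = past n g ((std_inv n g ^^ j) x)"
  by (simp add: tail_from_def past_def funpow_add)

lemma tail_from_1_past: "tail_from 1 (past n g x) = past n g (std_inv n g x)"
  by (simp add: tail_from_past)

text \<open>As long as the letters agree, \<open>x < y\<close> is passed on to the preimages; at the
  first index where agreement may fail, the letters can therefore only be in weakly increasing
  order.\<close>

lemma past_first_difference:
  assumes "x \<in> {1..n}" "y \<in> {1..n}" "x < y"
    and "\<And>i. i < m \<Longrightarrow> past n g (std_inv n g x) i = past n g (std_inv n g y) i"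
  shows "past n g (std_inv n g x) m \<le> past n g (std_inv n g y) m"
  using assms
proof (induction m arbitrary: x y)
  case 0
  then show ?case using less_iff_std_inv[of x n y g] by auto
next
  case (Suc m)
  have "std_inv n g x < std_inv n g y"
    using Suc.prems(4)[of 0] less_iff_std_inv[OF Suc.prems(1,2), of g] Suc.prems(3) by auto
  moreover have "past n g (std_inv n g (std_inv n g x)) i = past n g (std_inv n g (std_inv n g y)) i"
    if "i < m" for i
    using Suc.prems(4)[of "Suc i"] that by (simp add: past_Suc)
  ultimately show ?case
    using Suc.prems(1,2) by (simp only: past_Suc) (rule Suc.IH; simp only: std_inv_in)
qed

text \<open>Equality does occur: corresponding positions of distinct cycles with the same letters
  share their past.\<close>

lemma past_std_inv_mono:
  assumes "x \<in> {1..n}" "y \<in> {1..n}" "x < y"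
  shows "less_fun (past n g (std_inv n g x)) (past n g (std_inv n g y))
    \<or> past n g (std_inv n g x) = past n g (std_inv n g y)"
proof (rule ccontr)
  assume "\<not> ?thesis"
  then have "less_fun (past n g (std_inv n g y)) (past n g (std_inv n g x))"
    using less_fun_total by blast
  then obtain m where "past n g (std_inv n g y) m < past n g (std_inv n g x) m"
    "\<And>i. i < m \<Longrightarrow> past n g (std_inv n g y) i = past n g (std_inv n g x) i"
    by (auto elim: less_funE)
  then show False using past_first_difference[OF assms, of m g] by force
qed

lemma image_mset_std_inv:
  "image_mset (\<lambda>x. f (std_inv n g x)) (mset_set {1..n}) = image_mset f (mset_set {1..n})"
proof -
  have "image_mset (std_inv n g) (mset_set {1..n}) = mset_set {1..n}"
    using image_mset_mset_set[OF permutes_inj_on[OF std_inv_permutes]]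
    by (simp only: permutes_image[OF std_inv_permutes])
  then have "image_mset f (image_mset (std_inv n g) (mset_set {1..n})) = image_mset f (mset_set {1..n})"
    by (rule arg_cong)
  then show ?thesis unfolding multiset.map_comp comp_def .
qed

lemma size_pasts [simp]: "size (pasts n g) = n"
  by (simp add: pasts_def)

lemma tail_from_pasts: "image_mset (tail_from 1) (pasts n g) = pasts n g"
  using image_mset_std_inv[of "past n g" n g]
  by (simp add: pasts_def multiset.map_comp comp_def tail_from_past)

text \<open>Both \<open>tail_from 1 \<circ> u\<close> and \<open>u \<circ> std_inv n g\<close> list the same multiset in increasing lexicographic
  order, hence they agree.\<close>

lemma past_eqI:
  assumes inv: "image_mset (tail_from 1) (image_mset u (mset_set {1..n})) = image_mset u (mset_set {1..n})"
    and sorted: "\<And>x y. x \<in> {1..n} \<Longrightarrow> y \<in> {1..n} \<Longrightarrow> x < y \<Longrightarrow>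
      less_fun (tail_from 1 (u x)) (tail_from 1 (u y)) \<or> tail_from 1 (u x) = tail_from 1 (u y)"
    and g: "\<And>x. x \<in> {1..n} \<Longrightarrow> g x = u x 0"
    and x: "x \<in> {1..n}"
  shows "past n g x = u x"
proof -
  let ?b = "std_inv n g"
  have "map (\<lambda>x. tail_from 1 (u x)) [1..<Suc n] = map (\<lambda>x. u (?b x)) [1..<Suc n]"
  proof (rule lex_sorted_unique)
    show "mset (map (\<lambda>x. tail_from 1 (u x)) [1..<Suc n]) = mset (map (\<lambda>x. u (?b x)) [1..<Suc n])"
      unfolding mset_map_upt image_mset_std_inv using inv by (simp add: multiset.map_comp comp_def)
    show "sorted_wrt (\<lambda>u v. less_fun u v \<or> u = v) (map (\<lambda>x. tail_from 1 (u x)) [1..<Suc n])"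
      by (rule sorted_wrt_map_upt) (rule sorted)
    show "sorted_wrt (\<lambda>u v. less_fun u v \<or> u = v) (map (\<lambda>x. u (?b x)) [1..<Suc n])"
    proof (rule sorted_wrt_map_upt)
      fix x y assume xy: "x \<in> {1..n}" "y \<in> {1..n}" "x < y"
      let ?u = "u (?b x)" and ?v = "u (?b y)"
      have b: "?b x \<in> {1..n}" "?b y \<in> {1..n}" using xy by (simp_all only: std_inv_in)
      \<comment> \<open>\<open>std_inv\<close> lists positions by letter and breaks ties by
        position. Among sequences with the same first letter, the order of the tails given by
        \<open>sorted\<close> is the lexicographic order.\<close>
      consider "?u 0 < ?v 0" | "?u 0 = ?v 0" "?b x < ?b y"
        using less_iff_std_inv[OF xy(1,2), of g] xy(3) by (auto simp: g[OF b(1)] g[OF b(2)])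
      then show "less_fun ?u ?v \<or> ?u = ?v"
      proof cases
        case 1
        then show ?thesis unfolding less_fun_def by blast
      next
        case 2
        from sorted[OF b 2(2)] show ?thesis
        proof
          assume "less_fun (tail_from 1 ?u) (tail_from 1 ?v)"
          then obtain m where m: "?u (Suc m) < ?v (Suc m)" "\<And>i. i < m \<Longrightarrow> ?u (Suc i) = ?v (Suc i)"
            by (auto elim: less_funE)
          have "\<forall>i<Suc m. ?u i = ?v i"
            using m(2) 2(1) by (auto simp: less_Suc_eq_0_disj)
          then show ?thesis unfolding less_fun_def using m(1) by blast
        next
          assume eq: "tail_from 1 ?u = tail_from 1 ?v"
          have "?u m = ?v m" for m
            using 2(1) fun_cong[OF eq, of "m - 1"] by (cases m) auto
          then show ?thesis by blast
        qed
      qed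
    qed
  qed
  then have step: "tail_from 1 (u x) = u (?b x)" if "x \<in> {1..n}" for x
    using that unfolding map_eq_conv set_upt atLeastLessThanSuc_atLeastAtMost by blast
  \<comment> \<open>Shifting \<open>u\<close> now acts as \<open>std_inv\<close> on positions, so
    entry \<open>m\<close> of \<open>u x\<close> is the first entry of \<open>u\<close> at the
    \<open>m\<close>-th preimage, where it equals \<open>g\<close>.\<close>
  have "past n g x m = u x m" for m
    using x
  proof (induction m arbitrary: x)
    case 0
    then show ?case using g by simp
  next
    case (Suc m)
    have "past n g x (Suc m) = u (?b x) m"
      unfolding past_Suc by (rule Suc.IH) (use Suc.prems in \<open>simp only: std_inv_in\<close>)
    also have "\<dots> = u x (Suc m)"
      using fun_cong[OF step[OF Suc.prems], of m] by simp
    finally show ?case .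
  qed
  then show ?thesis by blast
qed

text \<open>An invariant multiset encodes a multiset of primitive necklaces of total length \<open>n\<close>, each
  necklace contributing the shift orbit of its periodic sequence.\<close>

definition necklaces :: "'a set \<Rightarrow> nat \<Rightarrow> (nat \<Rightarrow> 'a) multiset set" where
  "necklaces I n = {M. size M = n \<and> image_mset (tail_from 1) M = M \<and> (\<forall>u\<in>#M. range u \<subseteq> I)}"

text \<open>By invariance the shift maps the finite support onto itself, hence injectively. The
  first letter that a shift forgets is thus recoverable inside the multiset.\<close>

lemma inj_on_tail_from:
  assumes "image_mset (tail_from 1) M = M"
  shows "inj_on (tail_from 1) (set_mset M)"
proof (rule finite_surj_inj)
  show "set_mset M \<subseteq> tail_from 1 ` set_mset M"
    using arg_cong[OF assms, of set_mset] by simp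
qed simp

lemma bij_betw_pasts:
  "bij_betw (pasts n) ({1..n} \<rightarrow>\<^sub>E I) (necklaces I n)"
proof (rule bij_betwI')
  fix g h assume gh: "g \<in> {1..n} \<rightarrow>\<^sub>E I" "h \<in> {1..n} \<rightarrow>\<^sub>E I"
  show "pasts n g = pasts n h \<longleftrightarrow> g = h"
  proof
    assume eq: "pasts n g = pasts n h"
    \<comment> \<open>Only the shifted pasts are known to be sorted, so these are compared first;
      injectivity of the shift on the common support then gives the pasts themselves.\<close>
    let ?s = "\<lambda>f. map (\<lambda>x. tail_from 1 (past n f x)) [1..<Suc n]"
    have "?s g = ?s h"
    proof (rule lex_sorted_unique)
      have "mset (?s f) = image_mset (tail_from 1) (pasts n f)" for f
        unfolding mset_map_upt pasts_def by (simp add: multiset.map_comp comp_def)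
      then show "mset (?s g) = mset (?s h)" by (simp only: eq)
      show "sorted_wrt (\<lambda>u v. less_fun u v \<or> u = v) (?s g)"
        by (rule sorted_wrt_map_upt) (unfold tail_from_1_past, rule past_std_inv_mono)
      show "sorted_wrt (\<lambda>u v. less_fun u v \<or> u = v) (?s h)"
        by (rule sorted_wrt_map_upt) (unfold tail_from_1_past, rule past_std_inv_mono)
    qed
    then have *: "tail_from 1 (past n g x) = tail_from 1 (past n h x)" if "x \<in> {1..n}" for x
      using that unfolding map_eq_conv set_upt atLeastLessThanSuc_atLeastAtMost by blast
    have "g x = h x" if x: "x \<in> {1..n}" for x
    proof -
      have "past n f x \<in># pasts n f" for f
        using x by (simp add: pasts_def)
      then have "past n g x \<in># pasts n g" "past n h x \<in># pasts n g"
        using eq by metis+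
      then have "past n g x = past n h x"
        using inj_on_tail_from[OF tail_from_pasts, of n g] *[OF x] unfolding inj_on_def by blast
      then show ?thesis by (metis past_0)
    qed
    then show "g = h" using PiE_ext[OF gh] by blast
  qed simp
next
  fix g assume g: "g \<in> {1..n} \<rightarrow>\<^sub>E I"
  have "range (past n g x) \<subseteq> I" if "x \<in> {1..n}" for x
    using PiE_mem[OF g] funpow_std_inv_in[OF that] unfolding past_def by blast
  then have "\<forall>u\<in>#pasts n g. range u \<subseteq> I"
    by (auto simp: pasts_def)
  then show "pasts n g \<in> necklaces I n"
    unfolding necklaces_def using tail_from_pasts by simp
next
  fix M assume M: "M \<in> necklaces I n"
  \<comment> \<open>Positions are handed out in the order of the tails, the order that pasts must
    have; the first letters then define the word. List indices start at 0 and positions at 1, hence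
    \<open>x - 1\<close> below.\<close>
  obtain ys where ys: "mset ys = M"
    and sorted: "sorted_wrt (\<lambda>u v. less_fun u v \<or> u = v) (map (tail_from 1) ys)"
    by (rule lex_sort_exists)
  define u where "u x = ys ! (x - 1)" for x
  define g where "g = (\<lambda>x\<in>{1..n}. u x 0)"
  have len: "length ys = n" using M ys unfolding necklaces_def by auto
  have u: "image_mset u (mset_set {1..n}) = M"
  proof -
    have "map u [1..<Suc n] = ys"
      by (rule nth_equalityI) (simp_all add: len u_def del: upt_Suc)
    then show ?thesis by (metis mset_map_upt ys)
  qed
  have "past n g x = u x" if "x \<in> {1..n}" for x
  proof (rule past_eqI)
    show "image_mset (tail_from 1) (image_mset u (mset_set {1..n})) = image_mset u (mset_set {1..n})"
      using M unfolding u necklaces_def by blast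
    fix x y assume "x \<in> {1..n}" "y \<in> {1..n}" "x < y"
    then have "x - 1 < y - 1" "y - 1 < n" by auto
    then show "less_fun (tail_from 1 (u x)) (tail_from 1 (u y)) \<or> tail_from 1 (u x) = tail_from 1 (u y)"
      using sorted_wrt_nth_less[OF sorted[unfolded sorted_wrt_map], of "x - 1" "y - 1"]
      unfolding len u_def by simp
  qed (use that in \<open>simp_all add: g_def\<close>)
  then have "pasts n g = M"
    unfolding pasts_def u[symmetric] by (intro image_mset_cong) simp
  moreover have "g \<in> {1..n} \<rightarrow>\<^sub>E I"
  proof -
    have "u x \<in># M" if "x \<in> {1..n}" for x
      using that unfolding u[symmetric] by simp
    then have "u x 0 \<in> I" if "x \<in> {1..n}" for x
      using M that unfolding necklaces_def by blast
    then show ?thesis unfolding g_def by (rule restrict_PiE_iff[THEN iffD2, rule_format])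
  qed
  ultimately show "\<exists>g \<in> {1..n} \<rightarrow>\<^sub>E I. M = pasts n g" by blast
qed

section \<open>Periodic sequences\<close>

definition cyc :: "'a list \<Rightarrow> nat \<Rightarrow> 'a" where
  "cyc v m = v ! (m mod length v)"

lemma map_cyc [simp]: "map (cyc v) [0..<length v] = v"
  by (rule nth_equalityI) (simp_all add: cyc_def)

lemma cyc_map: "v \<noteq> [] \<Longrightarrow> cyc (map f v) m = f (cyc v m)"
  by (simp add: cyc_def)

lemma tail_from_cyc: "v \<noteq> [] \<Longrightarrow> tail_from j (cyc v) = cyc (rotate j v)"
  by (rule ext) (simp add: cyc_def nth_rotate add.commute mod_simps)

lemma tail_from_length_cyc [simp]: "tail_from (length v) (cyc v) = cyc v"
  by (rule ext) (simp add: cyc_def)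

lemma tail_from_add_length_cyc: "tail_from (j + length v) (cyc v) = tail_from j (cyc v)"
  by (metis tail_from_tail_from tail_from_length_cyc)

lemma tail_from_mult_length_cyc: "tail_from (length v * i) (cyc v) = cyc v"
  by (rule ext) (simp add: cyc_def)

lemma tail_from_mod_length_cyc: "tail_from (j mod length v) (cyc v) = tail_from j (cyc v)"
  by (rule ext) (simp add: cyc_def mod_simps)

lemma cyc_inject: "length v = length v' \<Longrightarrow> cyc v = cyc v' \<Longrightarrow> v = v'"
  by (metis map_cyc)

text \<open>Reduced modulo the length, a period that is not a multiple cuts \<open>v\<close> into
  two nonempty factors that commute; commuting words are powers of a common word, which makes
  \<open>v\<close> a power.\<close>

lemma primitive_period:
  assumes "v \<noteq> []" "\<not> is_power v" "tail_from d (cyc v) = cyc v"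
  shows "length v dvd d"
proof (rule ccontr)
  define e where "e = d mod length v"
  assume "\<not> length v dvd d"
  then have e: "0 < e" "e < length v"
    using \<open>v \<noteq> []\<close> by (auto simp: e_def dvd_eq_mod_eq_0)
  have "rotate d v = v"
    by (rule cyc_inject) (use assms in \<open>simp_all add: tail_from_cyc\<close>)
  then have "drop e v @ take e v = take e v @ drop e v"
    by (simp add: e_def rotate_drop_take)
  then obtain a b y where y: "concat (replicate a y) = drop e v" "concat (replicate b y) = take e v"
    using comm_append_are_replicate by blast
  then have "a \<noteq> 0" "b \<noteq> 0" using e by (auto intro!: Nat.gr0I)
  then have "a + b \<ge> 2" by simp
  moreover have "v = concat (replicate (b + a) y)"
    unfolding replicate_add concat_append y by simp
  ultimately show False
    using \<open>\<not> is_power v\<close> unfolding is_power_def by (metis add.commute)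
qed

text \<open>A periodic sequence is a tail of each of its own tails, so meeting in one tail makes
  \<open>cyc v\<close> a tail of \<open>cyc v'\<close>. It inherits the period
  \<open>length v'\<close>, which primitivity turns into divisibility.\<close>

lemma tails_meet:
  assumes v: "v \<noteq> []" "\<not> is_power v" and eq: "tail_from i (cyc v) = tail_from j (cyc v')"
  obtains m where "cyc v = tail_from m (cyc v')" "length v dvd length v'"
proof
  \<comment> \<open>After \<open>i\<close> shifts, \<open>length v * i - i\<close> more complete
    \<open>i\<close> full periods and bring back \<open>cyc v\<close>.\<close>
  define m where "m = length v * i - i + j"
  have "i \<le> length v * i" using v by (cases v) auto
  then have "cyc v = tail_from (length v * i - i) (tail_from i (cyc v))"
    by (simp add: tail_from_mult_length_cyc)
  then show m: "cyc v = tail_from m (cyc v')"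
    unfolding eq by (simp add: m_def)
  have "tail_from (length v') (cyc v) = tail_from m (tail_from (length v') (cyc v'))"
    unfolding m tail_from_tail_from by (simp add: add.commute)
  then have "tail_from (length v') (cyc v) = cyc v" by (simp add: m)
  then show "length v dvd length v'" by (rule primitive_period[OF v])
qed

text \<open>Divisibility in both directions gives equal lengths, so equal sequences have equal
  period words.\<close>

lemma conjugate_if_tails_meet:
  assumes v: "v \<noteq> []" "\<not> is_power v" and v': "v' \<noteq> []" "\<not> is_power v'"
    and eq: "tail_from i (cyc v) = tail_from j (cyc v')"
  shows "conjugate v v'"
proof -
  obtain m where m: "cyc v = tail_from m (cyc v')" "length v dvd length v'"
    by (rule tails_meet[OF v eq])
  moreover have "length v' dvd length v"
    by (rule tails_meet[OF v' eq[symmetric]])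
  ultimately have "v = rotate m v'"
    using v' by (intro cyc_inject) (simp_all add: tail_from_cyc dvd_antisym)
  then show ?thesis unfolding conjugate_def by blast
qed

lemma inj_on_tails_cyc:
  assumes v: "v \<noteq> []" "\<not> is_power v"
  shows "inj_on (\<lambda>j. tail_from j (cyc v)) {..<length v}"
proof (rule linorder_inj_onI')
  fix i j assume ij: "i \<in> {..<length v}" "j \<in> {..<length v}" "i < j"
  show "tail_from i (cyc v) \<noteq> tail_from j (cyc v)"
  proof
    assume eq: "tail_from i (cyc v) = tail_from j (cyc v)"
    \<comment> \<open>Shifting both tails by \<open>length v - i\<close> turns the first into
      \<open>cyc v\<close>, so the positive number \<open>j - i\<close> is a period below
      \<open>length v\<close>.\<close>
    have "tail_from (j - i) (cyc v) = tail_from (j + (length v - i)) (cyc v)"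
      using tail_from_add_length_cyc[of "j - i" v] ij by simp
    also have "\<dots> = tail_from (length v - i) (tail_from j (cyc v))"
      by (simp add: add.commute)
    also have "\<dots> = cyc v"
      using ij by (simp flip: eq)
    finally have "length v dvd j - i" by (rule primitive_period[OF v])
    then show False using ij by (auto dest: dvd_imp_le)
  qed
qed

lemma is_power_rev [simp]: "is_power (rev w) \<longleftrightarrow> is_power w"
proof -
  have "is_power (rev w)" if "is_power w" for w :: "'b list"
  proof -
    obtain y l where "l \<ge> 2" "w = concat (replicate l y)"
      using \<open>is_power w\<close> unfolding is_power_def by blast
    then have "l \<ge> 2" "rev w = concat (replicate l (rev y))"
      by (simp_all add: rev_concat)
    then show ?thesis unfolding is_power_def by blast
  qed
  then show ?thesis by (metis rev_rev_ident)
qed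

lemma conjugate_rev: "conjugate (rev v) (rev w) \<Longrightarrow> conjugate v w"
  unfolding conjugate_def by (metis rotate_rev rev_rev_ident)

section \<open>Shift orbits of periodic sequences\<close>

definition orbit_of :: "'a list \<Rightarrow> (nat \<Rightarrow> 'a) set" where
  "orbit_of v = range (\<lambda>j. tail_from j (cyc v))"

lemma orbit_of_eq:
  assumes "v \<noteq> []"
  shows "orbit_of v = (\<lambda>j. tail_from j (cyc v)) ` {..<length v}"
proof -
  have "tail_from j (cyc v) \<in> (\<lambda>j. tail_from j (cyc v)) ` {..<length v}" for j
    using assms by (intro image_eqI[of _ _ "j mod length v"]) (simp_all add: tail_from_mod_length_cyc)
  then show ?thesis unfolding orbit_of_def by blast
qed

lemma finite_orbit_of: "v \<noteq> [] \<Longrightarrow> finite (orbit_of v)"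
  by (simp add: orbit_of_eq)

lemma card_orbit_of: "v \<noteq> [] \<Longrightarrow> \<not> is_power v \<Longrightarrow> card (orbit_of v) = length v"
  by (simp add: orbit_of_eq card_image inj_on_tails_cyc)

lemma image_mset_tail_from_orbit_of:
  assumes "v \<noteq> []"
  shows "image_mset (tail_from 1) (mset_set (orbit_of v)) = mset_set (orbit_of v)"
proof -
  \<comment> \<open>\<open>length v - 1\<close> shifts undo one shift, so the shift is onto the
    finite orbit and therefore a permutation of it.\<close>
  have "tail_from j (cyc v) = tail_from 1 (tail_from (j + (length v - 1)) (cyc v))" for j
    using assms tail_from_add_length_cyc[of j v] by (cases v) simp_all
  then have sub: "orbit_of v \<subseteq> tail_from 1 ` orbit_of v"
    unfolding orbit_of_def by blast
  have inj: "inj_on (tail_from 1) (orbit_of v)"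
    by (rule finite_surj_inj[OF finite_orbit_of[OF assms] sub])
  have "tail_from 1 ` orbit_of v \<subseteq> orbit_of v"
    unfolding orbit_of_def by (auto simp: image_iff)
  then have "tail_from 1 ` orbit_of v = orbit_of v" using sub by blast
  then show ?thesis by (simp only: image_mset_mset_set[OF inj])
qed

section \<open>Cycles\<close>

text \<open>With equal pasts every comparison of letters is a tie, so the order of the positions is
  kept at each step back.\<close>

lemma past_eq_less:
  assumes "x \<in> {1..n}" "y \<in> {1..n}" "past n g x = past n g y" "x < y"
  shows "(std_inv n g ^^ m) x < (std_inv n g ^^ m) y"
  using assms
proof (induction m arbitrary: x y)
  case (Suc m)
  let ?b = "std_inv n g"
  have "past n g (?b x) = past n g (?b y)"
    using Suc.prems(3) by (metis tail_from_1_past)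
  moreover from this have "g (?b x) = g (?b y)" by (metis past_0)
  then have "?b x < ?b y"
    using Suc.prems(4) less_iff_std_inv[OF Suc.prems(1,2), of g] by auto
  ultimately have "(?b ^^ m) (?b x) < (?b ^^ m) (?b y)"
    using Suc.prems(1,2) by (intro Suc.IH) (simp_all only: std_inv_in)
  then show ?case by (simp add: funpow_swap1)
qed simp

text \<open>Backward iteration is strictly increasing on the positions with a common past, and a strictly
  monotone self-map of a finite chain has only trivial orbits.\<close>

lemma periodic_past_cycle:
  assumes x: "x \<in> {1..n}" and per: "tail_from k (past n g x) = past n g x"
  shows "(std_inv n g ^^ k) x = x"
proof (rule ccontr)
  let ?b = "std_inv n g"
  define h where "h i = (?b ^^ (k * i)) x" for i
  define y where "y = (?b ^^ k) x"
  have h_Suc: "h (Suc i) = (?b ^^ (k * i)) y" for i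
    using funpow_add[of "k * i" k ?b] by (simp add: h_def y_def add.commute)
  have y: "y \<in> {1..n}" "past n g x = past n g y"
    using per x unfolding y_def tail_from_past by (simp_all only: funpow_std_inv_in)
  have h_in: "h i \<in> {1..n}" for i
    unfolding h_def by (rule funpow_std_inv_in[OF x])
  assume "(?b ^^ k) x \<noteq> x"
  \<comment> \<open>Jumps of \<open>k\<close> steps preserve the past, so the orbit of
    \<open>x\<close> under them is strictly monotone: an increasing one passes \<open>n\<close>, a
    decreasing one would have to go below 0.\<close>
  then consider "x < y" | "y < x" unfolding y_def by linarith
  then show False
  proof cases
    case 1
    then have "h i < h (Suc i)" for i
      unfolding h_Suc unfolding h_def by (intro past_eq_less x y)
    then have "i \<le> h i" for i
      by (intro strict_mono_imp_increasing) (simp add: strict_mono_Suc_iff)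
    from this[of "Suc n"] h_in[of "Suc n"] show False by simp
  next
    case 2
    then have "h (Suc i) < h i" for i
      unfolding h_Suc unfolding h_def by (intro past_eq_less x y y(2)[symmetric])
    then have "h i + i \<le> h 0" for i
      by (induction i) (auto, metis Suc_leI add_Suc_right add_Suc add_le_mono1 le_trans)
    from this[of "Suc (h 0)"] show False by simp
  qed
qed

lemma rotate1_rev_rotate1 [simp]: "rotate1 (rev (rotate1 xs)) = rev xs"
  by (cases xs) simp_all

text \<open>Traversing a cycle backward: this translates between cycles of \<open>std\<close> and
  orbits of \<open>std_inv\<close>, in either direction.\<close>

lemma map_rev_eq_rotate1:
  assumes "map f zs = rotate1 zs" and "\<And>x. h (f x) = x"
  shows "map h (rev zs) = rotate1 (rev zs)"
proof -
  have "zs = map h (rotate1 zs)"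
    unfolding assms(1)[symmetric] by (simp add: assms(2) comp_def)
  then have "rotate1 (rev zs) = rotate1 (rev (map h (rotate1 zs)))" by simp
  also have "\<dots> = map h (rotate1 (rev (rotate1 zs)))"
    by (simp add: rev_map rotate1_map)
  finally show ?thesis by simp
qed

text \<open>A cycle spelling \<open>w\<close> has exactly one position with past
  \<open>cyc (rev w)\<close>, the last entry of the spelling: by primitivity the shifts of this
  sequence within one period are distinct. Hence such positions and the counted cycles
  correspond.\<close>

lemma D_eq_count:
  assumes w: "w \<noteq> []" "\<not> is_power w"
  shows "D n w g = count (pasts n g) (cyc (rev w))"
proof -
  let ?b = "std_inv n g"
  define v where "v = rev w"
  define k where "k = length v"
  define X where "X = {x \<in> {1..n}. past n g x = cyc v}"
  define F where "F x = (\<lambda>i. (?b ^^ i) x) ` {..<k}" for x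
  have v: "v \<noteq> []" "\<not> is_power v" "w = rev v" using w by (simp_all add: v_def)
  have k: "k > 0" using v by (simp add: k_def)
  have past_iter: "past n g ((?b ^^ i) x) = tail_from i (cyc v)" if "x \<in> X" for x i
    using that tail_from_past[of i n g x] by (simp add: X_def)
  have "bij_betw F X {set xs | xs. writes_cycle n (std n g) xs \<and> map g xs = w}"
  proof (rule bij_betwI')
    fix x y assume xy: "x \<in> X" "y \<in> X"
    show "F x = F y \<longleftrightarrow> x = y"
    proof
      assume "F x = F y"
      moreover have "y \<in> F y" unfolding F_def using k by (intro image_eqI[of _ _ 0]) simp_all
      ultimately obtain j where j: "j < k" "y = (?b ^^ j) x" by (auto simp: F_def)
      then have "tail_from 0 (cyc v) = tail_from j (cyc v)"
        using past_iter[OF xy(1), of j] xy(2) by (simp add: X_def)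
      then have "j = 0"
        using inj_on_tails_cyc[OF v(1,2)] j k unfolding inj_on_def k_def by blast
      then show "x = y" using j by simp
    qed simp
  next
    fix x assume x: "x \<in> X"
    then have xn: "x \<in> {1..n}" and past: "past n g x = cyc v" by (simp_all add: X_def)
    define zs where "zs = map (\<lambda>i. (?b ^^ i) x) [0..<k]"
    \<comment> \<open>A past of period \<open>k\<close> forces the positions themselves, not only
      their letters, to return after \<open>k\<close> steps.\<close>
    have cycle: "(?b ^^ k) x = x"
      by (rule periodic_past_cycle[OF xn]) (simp add: past k_def)
    have "inj_on (\<lambda>i. (?b ^^ i) x) {..<k}"
    proof (rule inj_onI)
      fix i j assume ij: "i \<in> {..<k}" "j \<in> {..<k}" "(?b ^^ i) x = (?b ^^ j) x"
      then have "tail_from i (cyc v) = tail_from j (cyc v)"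
        using past_iter[OF x] by metis
      then show "i = j"
        using inj_on_tails_cyc[OF v(1,2)] ij unfolding inj_on_def k_def by blast
    qed
    then have "distinct zs" by (simp add: zs_def distinct_map atLeast0LessThan)
    moreover have "zs \<noteq> []" using k by (simp add: zs_def)
    moreover have "set zs \<subseteq> {1..n}"
      unfolding zs_def set_map using funpow_std_inv_in[OF xn] by blast
    moreover have "map (std n g) (rev zs) = rotate1 (rev zs)"
    proof (rule map_rev_eq_rotate1)
      show "map ?b zs = rotate1 zs"
      proof (rule nth_equalityI)
        fix i assume "i < length (map ?b zs)"
        then have i: "i < k" by (simp add: zs_def)
        then have "rotate1 zs ! i = (?b ^^ (Suc i mod k)) x"
          using k by (simp add: nth_rotate1 zs_def)
        also have "\<dots> = (?b ^^ Suc i) x"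
          by (rule funpow_mod_eq[OF cycle])
        finally show "map ?b zs ! i = rotate1 zs ! i"
          using i by (simp add: zs_def)
      qed simp
    qed simp
    moreover have "map g zs = v"
      unfolding zs_def map_map comp_def using map_cyc[of v]
      unfolding past[symmetric] past_def k_def by simp
    then have "map g (rev zs) = w" by (simp only: v(3) flip: rev_map)
    moreover have "F x = set (rev zs)"
      by (simp add: F_def zs_def atLeast0LessThan)
    ultimately have "writes_cycle n (std n g) (rev zs)" "map g (rev zs) = w" "F x = set (rev zs)"
      unfolding writes_cycle_def by simp_all
    then show "F x \<in> {set xs | xs. writes_cycle n (std n g) xs \<and> map g xs = w}" by blast
  next
    fix S assume "S \<in> {set xs | xs. writes_cycle n (std n g) xs \<and> map g xs = w}"
    then obtain xs where xs: "S = set xs" "xs \<noteq> []" "set xs \<subseteq> {1..n}"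
      "map (std n g) xs = rotate1 xs" "map g xs = w"
      unfolding writes_cycle_def by blast
    define zs where "zs = rev xs"
    have zs: "zs \<noteq> []" "map g zs = v" "length zs = k"
      using xs by (auto simp: zs_def v_def k_def rev_map)
    have rot: "map ?b zs = rotate1 zs"
      unfolding zs_def by (rule map_rev_eq_rotate1[OF xs(4)]) simp
    have step: "?b (cyc zs m) = cyc zs (Suc m)" for m
      using fun_cong[OF tail_from_cyc[OF zs(1), of 1], of m] cyc_map[OF zs(1), of ?b m]
      by (simp add: rot)
    \<comment> \<open>This is the last entry of \<open>xs\<close>; backward steps from it read
      \<open>xs\<close> from right to left.\<close>
    define x where "x = cyc zs 0"
    have iter: "(?b ^^ m) x = cyc zs m" for m
      by (induction m) (simp_all add: x_def step)
    have "x \<in> set zs" unfolding x_def cyc_def using zs(1) by (intro nth_mem) simp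
    then have "x \<in> {1..n}" using xs(3) by (auto simp: zs_def)
    moreover have "past n g x = cyc v"
      unfolding past_def iter by (simp add: cyc_map[OF zs(1), symmetric] zs(2))
    ultimately have "x \<in> X" by (simp add: X_def)
    moreover have "F x = set (map (cyc zs) [0..<length zs])"
      unfolding F_def iter by (simp only: set_map set_upt zs(3) atLeast0LessThan)
    then have "F x = set zs" by (simp only: map_cyc)
    then have "S = F x" by (simp add: xs(1) zs_def)
    ultimately show "\<exists>x\<in>X. S = F x" by blast
  qed
  from bij_betw_same_card[OF this] have "D n w g = card X"
    unfolding D_def cycle_count_def ..
  also have "\<dots> = count (pasts n g) (cyc v)"
  proof -
    have "count (pasts n g) (cyc v) = (\<Sum>x\<in>X. count (mset_set {1..n}) x)"
      unfolding pasts_def count_image_mset by (rule sum.cong) (auto simp: X_def)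
    also have "\<dots> = (\<Sum>x\<in>X. 1)" by (rule sum.cong) (simp_all add: X_def)
    finally show ?thesis by simp
  qed
  finally show ?thesis by (simp add: v_def)
qed

text \<open>Bridges the random vector, defined on all of \<open>nat\<close>, and the extensional
  functions on \<open>{1..n}\<close> for which the bijection is stated.\<close>

lemma D_restrict: "D n w (restrict g {1..n}) = D n w g"
proof -
  have "is_std n (restrict g {1..n}) = is_std n g"
    by (rule ext) (simp add: is_std_def)
  then have "std n (restrict g {1..n}) = std n g" by (simp add: std_def)
  moreover have "map (restrict g {1..n}) xs = map g xs" if "writes_cycle n \<sigma> xs" for xs \<sigma>
    using that by (auto simp: writes_cycle_def)
  ultimately show ?thesis
    unfolding D_def cycle_count_def by metis
qed

section \<open>Sums of orbits\<close>

definition orbit_sum :: "'i set \<Rightarrow> ('i \<Rightarrow> nat) \<Rightarrow> ('i \<Rightarrow> 'a list) \<Rightarrow> (nat \<Rightarrow> 'a) multiset" where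
  "orbit_sum A l v = (\<Sum>a\<in>A. repeat_mset (l a) (mset_set (orbit_of (v a))))"

lemma image_mset_repeat_mset: "image_mset f (repeat_mset c M) = repeat_mset c (image_mset f M)"
  by (induction c) simp_all

lemma image_mset_sum: "image_mset f (sum h A) = (\<Sum>a\<in>A. image_mset f (h a))"
  by (induction A rule: infinite_finite_induct) simp_all

lemma size_sum_mset_family: "size (sum h A :: 'b multiset) = (\<Sum>a\<in>A. size (h a))"
  by (induction A rule: infinite_finite_induct) simp_all

text \<open>First letters suffice: on \<open>pasts n g\<close> they are the letters of
  \<open>g\<close>, which gives the probability of \<open>g\<close>, and on the orbit of a primitive
  word they run once through its letters.\<close>

definition head_weight :: "('a \<Rightarrow> real) \<Rightarrow> (nat \<Rightarrow> 'a) multiset \<Rightarrow> real" where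
  "head_weight p M = (\<Prod>u\<in>#M. p (u 0))"

lemma head_weight_empty [simp]: "head_weight p {#} = 1"
  by (simp add: head_weight_def)

lemma head_weight_union [simp]: "head_weight p (M + N) = head_weight p M * head_weight p N"
  by (simp add: head_weight_def)

lemma head_weight_repeat_mset: "head_weight p (repeat_mset c M) = head_weight p M ^ c"
  by (induction c) simp_all

lemma head_weight_sum: "head_weight p (sum h A) = (\<Prod>a\<in>A. head_weight p (h a))"
  by (induction A rule: infinite_finite_induct) simp_all

lemma head_weight_nonneg:
  assumes "M \<in> necklaces I n" "\<And>i. i \<in> I \<Longrightarrow> p i \<ge> 0"
  shows "head_weight p M \<ge> 0"
proof -
  have "\<forall>u\<in>#M. p (u 0) \<ge> 0" using assms unfolding necklaces_def by blast
  then show ?thesis unfolding head_weight_def by (induction M) simp_all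
qed

lemma head_weight_pasts: "head_weight p (pasts n g) = (\<Prod>j\<in>{1..n}. p (g j))"
  unfolding head_weight_def pasts_def
  by (simp add: multiset.map_comp comp_def prod_unfold_prod_mset)

lemma head_weight_orbit_of:
  assumes "v \<noteq> []" "\<not> is_power v"
  shows "head_weight p (mset_set (orbit_of v)) = word_weight p v"
proof -
  have "head_weight p (mset_set (orbit_of v)) = (\<Prod>u\<in>orbit_of v. p (u 0))"
    by (simp add: head_weight_def prod_unfold_prod_mset)
  also have "\<dots> = (\<Prod>j<length v. p (v ! j))"
    unfolding orbit_of_eq[OF assms(1)]
    by (subst prod.reindex[OF inj_on_tails_cyc[OF assms]]) (simp add: cyc_def)
  also have "\<dots> = word_weight p v"
    by (simp add: word_weight_def prod.list_conv_set_nth atLeast0LessThan)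
  finally show ?thesis .
qed

text \<open>The shift sends all copies of a sequence to copies of its tail, and the image of the
  multiset is the multiset itself. A lower bound at one sequence thus spreads along its
  orbit.\<close>

lemma count_le_count_tail_from:
  assumes "image_mset (tail_from 1) M = M"
  shows "count M u \<le> count M (tail_from j u)"
proof (induction j)
  case (Suc j)
  let ?u = "tail_from j u"
  have "image_mset (tail_from 1) (replicate_mset (count M ?u) ?u) \<subseteq># image_mset (tail_from 1) M"
    by (intro image_mset_subseteq_mono) (simp flip: count_le_replicate_mset_subset_eq)
  then have "count M ?u \<le> count M (tail_from 1 ?u)"
    unfolding assms image_replicate_mset by (simp only: count_le_replicate_mset_subset_eq)
  then show ?case using Suc.IH by (simp del: tail_from_apply)
qed simp

section \<open>Orbit sums inside invariant multisets\<close>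

lemma count_orbit_sum:
  assumes "\<And>a. a \<in> A \<Longrightarrow> v a \<noteq> []"
  shows "count (orbit_sum A l v) u = (\<Sum>a\<in>A. if u \<in> orbit_of (v a) then l a else 0)"
  unfolding orbit_sum_def count_sum
  by (rule sum.cong) (simp_all add: count_mset_set' assms finite_orbit_of)

text \<open>Non-conjugate primitive words have disjoint orbits, so each sequence is counted by at
  most one summand, and invariance reduces the comparison on an orbit to
  \<open>cyc (v a)\<close>.\<close>

lemma orbit_sum_subset_iff:
  assumes A: "finite A" and v: "\<And>a. a \<in> A \<Longrightarrow> v a \<noteq> []" "\<And>a. a \<in> A \<Longrightarrow> \<not> is_power (v a)"
    and nonconj: "\<And>a b. a \<in> A \<Longrightarrow> b \<in> A \<Longrightarrow> a \<noteq> b \<Longrightarrow> \<not> conjugate (v a) (v b)"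
    and inv: "image_mset (tail_from 1) M = M"
  shows "orbit_sum A l v \<subseteq># M \<longleftrightarrow> (\<forall>a\<in>A. l a \<le> count M (cyc (v a)))"
proof -
  have count: "count (orbit_sum A l v) u = (\<Sum>a\<in>A. if u \<in> orbit_of (v a) then l a else 0)" for u
    by (rule count_orbit_sum) (rule v(1))
  have in_orbit: "cyc w \<in> orbit_of w" for w :: "'b list"
    unfolding orbit_of_def by (intro range_eqI[of _ _ 0]) simp
  show ?thesis
  proof
    assume sub: "orbit_sum A l v \<subseteq># M"
    show "\<forall>a\<in>A. l a \<le> count M (cyc (v a))"
    proof
      fix a assume "a \<in> A"
      then have "l a \<le> count (orbit_sum A l v) (cyc (v a))"
        using A in_orbit[of "v a"] member_le_sum[of a A "\<lambda>b. if cyc (v a) \<in> orbit_of (v b) then l b else 0"]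
        unfolding count by simp
      also have "\<dots> \<le> count M (cyc (v a))"
        using sub by (rule mset_subset_eq_count)
      finally show "l a \<le> count M (cyc (v a))" .
    qed
  next
    assume le: "\<forall>a\<in>A. l a \<le> count M (cyc (v a))"
    show "orbit_sum A l v \<subseteq># M"
    proof (rule mset_subset_eqI)
      fix u
      show "count (orbit_sum A l v) u \<le> count M u"
      proof (cases "\<exists>a\<in>A. u \<in> orbit_of (v a)")
        case True
        then obtain a j where a: "a \<in> A" "u = tail_from j (cyc (v a))" by (auto simp: orbit_of_def)
        have "u \<notin> orbit_of (v b)" if "b \<in> A" "b \<noteq> a" for b
        proof
          assume "u \<in> orbit_of (v b)"
          then obtain i where "u = tail_from i (cyc (v b))" by (auto simp: orbit_of_def)
          then have "conjugate (v b) (v a)"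
            using a that v by (intro conjugate_if_tails_meet[of _ _ i j]) simp_all
          then show False using nonconj[OF that(1) a(1) that(2)] by blast
        qed
        then have "count (orbit_sum A l v) u \<le> (\<Sum>b\<in>A. if b = a then l a else 0)"
          unfolding count by (intro sum_mono) auto
        also have "\<dots> = l a" using A a by simp
        also have "\<dots> \<le> count M (cyc (v a))" using le a by blast
        also have "\<dots> \<le> count M u" unfolding a(2) by (rule count_le_count_tail_from[OF inv])
        finally show ?thesis .
      qed (simp add: count)
    qed
  qed
qed

lemma orbit_sum_in_necklaces:
  assumes v: "\<And>a. a \<in> A \<Longrightarrow> v a \<noteq> []" "\<And>a. a \<in> A \<Longrightarrow> set (v a) \<subseteq> I"
  shows "orbit_sum A l v \<in> necklaces I (size (orbit_sum A l v))"
proof -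
  have "image_mset (tail_from 1) (orbit_sum A l v) = orbit_sum A l v"
    unfolding orbit_sum_def image_mset_sum image_mset_repeat_mset
    by (intro sum.cong refl arg_cong2[of _ _ _ _ repeat_mset] image_mset_tail_from_orbit_of v)
  moreover have "range u \<subseteq> I" if "a \<in> A" "u \<in> orbit_of (v a)" for a u
    using that v by (fastforce simp: orbit_of_def cyc_def)
  moreover have "\<exists>a\<in>A. u \<in> orbit_of (v a)" if "u \<in># orbit_sum A l v" for u
  proof (rule ccontr)
    assume "\<not> ?thesis"
    then have "count (orbit_sum A l v) u = 0"
      by (subst count_orbit_sum) (simp_all add: v(1))
    then show False using that by (simp add: count_eq_zero_iff)
  qed
  ultimately show ?thesis unfolding necklaces_def by blast
qed

lemma size_orbit_sum:
  assumes "\<And>a. a \<in> A \<Longrightarrow> v a \<noteq> []" "\<And>a. a \<in> A \<Longrightarrow> \<not> is_power (v a)"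
  shows "size (orbit_sum A l v) = (\<Sum>a\<in>A. length (v a) * l a)"
  unfolding orbit_sum_def size_sum_mset_family
  by (rule sum.cong) (simp_all add: assms card_orbit_of)

lemma head_weight_orbit_sum:
  assumes "\<And>a. a \<in> A \<Longrightarrow> v a \<noteq> []" "\<And>a. a \<in> A \<Longrightarrow> \<not> is_power (v a)"
  shows "head_weight p (orbit_sum A l v) = (\<Prod>a\<in>A. word_weight p (v a) ^ l a)"
  unfolding orbit_sum_def head_weight_sum
  by (rule prod.cong) (simp_all add: assms head_weight_repeat_mset head_weight_orbit_of)

text \<open>Shift invariance survives the removal of an invariant submultiset because images commute
  with such differences, so adding and removing \<open>B\<close> are inverse to each other.\<close>

lemma bij_betw_add_necklaces:
  assumes B: "B \<in> necklaces I m"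
  shows "bij_betw (\<lambda>M. M + B) (necklaces I n) {M \<in> necklaces I (n + m). B \<subseteq># M}"
proof (rule bij_betw_byWitness[where f' = "\<lambda>M. M - B"])
  show "(\<lambda>M. M + B) ` necklaces I n \<subseteq> {M \<in> necklaces I (n + m). B \<subseteq># M}"
    using B by (auto simp: necklaces_def image_subset_iff)
  have "M - B \<in> necklaces I n" if M: "M \<in> necklaces I (n + m)" "B \<subseteq># M" for M
    using M B image_mset_Diff[OF M(2), of "tail_from 1"]
    unfolding necklaces_def by (auto simp: size_Diff_submset dest: in_diffD)
  then show "(\<lambda>M. M - B) ` {M \<in> necklaces I (n + m). B \<subseteq># M} \<subseteq> necklaces I n" by blast
qed simp_all

section \<open>Distribution of the counts\<close>

text \<open>The event splits into countably many elementary ones, each a product of probabilities by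
  independence. The length \<open>m\<close> is left free so that initial segments of the random
  vector can be used as well.\<close>

lemma (in prob_space) emeasure_tuple:
  fixes m :: nat
  assumes I: "countable I" and X: "indep_vars (\<lambda>_. count_space I) X {1..m}"
    and p: "\<And>j i. j \<in> {1..m} \<Longrightarrow> i \<in> I \<Longrightarrow> prob {\<omega> \<in> space M. X j \<omega> = i} = p i"
    and S: "S \<subseteq> {1..m} \<rightarrow>\<^sub>E I"
  shows "emeasure M {\<omega> \<in> space M. (\<lambda>j\<in>{1..m}. X j \<omega>) \<in> S} =
      (\<integral>\<^sup>+ g. ennreal (\<Prod>j\<in>{1..m}. p (g j)) \<partial>count_space S)"
proof -
  define E where "E g = {\<omega> \<in> space M. (\<lambda>j\<in>{1..m}. X j \<omega>) = g}" for g
  have E: "E g \<in> events \<and> emeasure M (E g) = ennreal (\<Prod>j\<in>{1..m}. p (g j))" if "g \<in> S" for g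
  proof -
    have g: "g \<in> {1..m} \<rightarrow>\<^sub>E I" using that S by blast
    have rv: "random_variable (count_space I) (X j)" if "j \<in> {1..m}" for j
      using X that unfolding indep_vars_def2 by blast
    have slice: "X j -` {g j} \<inter> space M \<in> events" "prob (X j -` {g j} \<inter> space M) = p (g j)"
      if "j \<in> {1..m}" for j
    proof -
      have gj: "g j \<in> I" using g that by (rule PiE_mem)
      then show "X j -` {g j} \<inter> space M \<in> events"
        by (intro measurable_sets[OF rv[OF that]]) simp
      have "X j -` {g j} \<inter> space M = {\<omega> \<in> space M. X j \<omega> = g j}" by auto
      then show "prob (X j -` {g j} \<inter> space M) = p (g j)"
        using p[OF that gj] by simp
    qed
    \<comment> \<open>Length 0 does occur, when the orbit sum has size \<open>n\<close>; an
      intersection over no indices would be \<open>UNIV\<close> instead of the space.\<close>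
    show ?thesis
    proof (cases "m = 0")
      case True
      then have "E g = space M" using g by (auto simp: E_def)
      then show ?thesis using True by (simp add: emeasure_space_1)
    next
      case False
      then have ne: "{1..m} \<noteq> {}" by simp
      have eq: "E g = (\<Inter>j\<in>{1..m}. X j -` {g j} \<inter> space M)"
      proof (rule set_eqI)
        fix \<omega>
        have "(\<lambda>j\<in>{1..m}. X j \<omega>) = g \<longleftrightarrow> (\<forall>j\<in>{1..m}. X j \<omega> = g j)"
          using g by (auto simp: fun_eq_iff restrict_def PiE_def extensional_def)
        then show "\<omega> \<in> E g \<longleftrightarrow> \<omega> \<in> (\<Inter>j\<in>{1..m}. X j -` {g j} \<inter> space M)"
          using ne unfolding E_def by blast
      qed
      have "E g \<in> events"
        unfolding eq using ne slice(1) by (intro sets.finite_INT) simp_all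
      moreover have "prob (E g) = (\<Prod>j\<in>{1..m}. p (g j))"
        unfolding eq using indep_varsD_finite[OF X ne, of "\<lambda>j. {g j}"] PiE_mem[OF g] slice(2)
        by simp
      ultimately show ?thesis by (simp add: emeasure_eq_measure)
    qed
  qed
  have "countable ({1..m} \<rightarrow>\<^sub>E I)" by (intro countable_PiE I) simp
  then have count: "countable S" by (rule countable_subset[OF S])
  have UN: "{\<omega> \<in> space M. (\<lambda>j\<in>{1..m}. X j \<omega>) \<in> S} = \<Union> (E ` S)"
    by (auto simp: E_def)
  have "emeasure M (\<Union> (E ` S)) = (\<integral>\<^sup>+ g. emeasure M (E g) \<partial>count_space S)"
    using E count by (intro emeasure_UN_countable) (auto simp: disjoint_family_on_def E_def)
  also have "\<dots> = (\<integral>\<^sup>+ g. ennreal (\<Prod>j\<in>{1..m}. p (g j)) \<partial>count_space S)"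
    using E by (intro nn_integral_cong) simp
  finally show "emeasure M {\<omega> \<in> space M. (\<lambda>j\<in>{1..m}. X j \<omega>) \<in> S} =
    (\<integral>\<^sup>+ g. ennreal (\<Prod>j\<in>{1..m}. p (g j)) \<partial>count_space S)"
    unfolding UN .
qed

lemma nn_integral_pasts:
  assumes "bij_betw (pasts n) S T"
  shows "(\<integral>\<^sup>+ g. ennreal (\<Prod>j\<in>{1..n}. p (g j)) \<partial>count_space S) =
    (\<integral>\<^sup>+ M. ennreal (head_weight p M) \<partial>count_space T)"
  unfolding nn_integral_bij_count_space[OF assms, symmetric] head_weight_pasts ..

theorem theorem1p1:
  fixes M :: "'a measure" and I :: "real set" and p :: "real \<Rightarrow> real"
    and G :: "nat \<Rightarrow> 'a \<Rightarrow> real"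
    and n r :: nat and k l :: "nat \<Rightarrow> nat" and w :: "nat \<Rightarrow> real list"
  assumes "prob_space M"
    and "countable I"
    and "n \<ge> 1"
    and "prob_space.indep_vars M (\<lambda>_. count_space I) G {1..n}"
    and "\<And>j i. j \<in> {1..n} \<Longrightarrow> i \<in> I \<Longrightarrow> measure M {\<omega> \<in> space M. G j \<omega> = i} = p i"
    and "\<And>a. a \<in> {1..r} \<Longrightarrow> k a \<ge> 1"
    and "\<And>a. a \<in> {1..r} \<Longrightarrow> w a \<in> primitive_words I (k a)"
    and "\<And>a b. a \<in> {1..r} \<Longrightarrow> b \<in> {1..r} \<Longrightarrow> a \<noteq> b \<Longrightarrow> \<not> conjugate (w a) (w b)"
  shows "measure M {\<omega> \<in> space M. \<forall>a\<in>{1..r}. D n (w a) (\<lambda>j. G j \<omega>) \<ge> l a} =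
    (if (\<Sum>a\<in>{1..r}. k a * l a) \<le> n then (\<Prod>a\<in>{1..r}. word_weight p (w a) ^ l a) else 0)"
proof -
  interpret prob_space M by fact
  \<comment> \<open>Pasts read cycles against their direction, hence the reversed words.\<close>
  define v where "v a = rev (w a)" for a
  define B where "B = orbit_sum {1..r} l v"
  define N where "N = {L \<in> necklaces I n. B \<subseteq># L}"
  define S where "S = {g \<in> {1..n} \<rightarrow>\<^sub>E I. pasts n g \<in> N}"
  have w: "w a \<noteq> []" "\<not> is_power (w a)" "length (w a) = k a" "set (w a) \<subseteq> I" if "a \<in> {1..r}" for a
    using assms(6,7)[OF that] unfolding primitive_words_def by auto
  then have v: "v a \<noteq> []" "\<not> is_power (v a)" "length (v a) = k a" "set (v a) \<subseteq> I" if "a \<in> {1..r}" for a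
    using that by (simp_all add: v_def)
  have nonconj: "\<not> conjugate (v a) (v b)" if "a \<in> {1..r}" "b \<in> {1..r}" "a \<noteq> b" for a b
    using assms(8)[OF that] conjugate_rev unfolding v_def by blast
  have size_B: "size B = (\<Sum>a\<in>{1..r}. k a * l a)"
    unfolding B_def by (subst size_orbit_sum) (use v in \<open>auto intro!: sum.cong\<close>)
  have weight_B: "head_weight p B = (\<Prod>a\<in>{1..r}. word_weight p (w a) ^ l a)"
    unfolding B_def
    by (subst head_weight_orbit_sum) (use v in \<open>auto simp: v_def word_weight_def simp flip: rev_map\<close>)
  have B: "B \<in> necklaces I (size B)"
    unfolding B_def by (rule orbit_sum_in_necklaces) (use v in blast)+
  \<comment> \<open>\<open>n \<ge> 1\<close> provides the index 1, at which each \<open>p i\<close>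
    is a probability.\<close>
  have p_nonneg: "p i \<ge> 0" if "i \<in> I" for i
    using assms(3) assms(5)[of 1 i] that measure_nonneg[of M "{\<omega> \<in> space M. G 1 \<omega> = i}"] by simp
  have weight_nonneg: "head_weight p L \<ge> 0" if "L \<in> necklaces I m" for L m
    by (rule head_weight_nonneg[OF that]) (rule p_nonneg)
  have mem: "(\<lambda>j\<in>{1..m}. G j \<omega>) \<in> {1..m} \<rightarrow>\<^sub>E I" if "\<omega> \<in> space M" "m \<le> n" for m \<omega>
  proof -
    have "G j \<omega> \<in> I" if "j \<in> {1..m}" for j
    proof -
      have "random_variable (count_space I) (G j)"
        using assms(4) that \<open>m \<le> n\<close> unfolding indep_vars_def2 by auto
      from measurable_space[OF this \<open>\<omega> \<in> space M\<close>] show ?thesis by simp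
    qed
    then show ?thesis by (auto simp: restrict_def)
  qed
  \<comment> \<open>The bijection is applied to the first \<open>m\<close> random letters: the
    weights are the law of the multiset of their pasts, so they add up to 1.\<close>
  have total: "(\<integral>\<^sup>+ L. ennreal (head_weight p L) \<partial>count_space (necklaces I m)) = 1" if "m \<le> n" for m
  proof -
    have sub: "{1..m} \<subseteq> {1..n}" using that by auto
    have "emeasure M {\<omega> \<in> space M. (\<lambda>j\<in>{1..m}. G j \<omega>) \<in> {1..m} \<rightarrow>\<^sub>E I} =
      (\<integral>\<^sup>+ L. ennreal (head_weight p L) \<partial>count_space (necklaces I m))"
      unfolding nn_integral_pasts[OF bij_betw_pasts, symmetric]
      by (rule emeasure_tuple[OF assms(2) indep_vars_subset[OF assms(4) sub]])
        (use sub assms(5) in auto)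
    moreover have "{\<omega> \<in> space M. (\<lambda>j\<in>{1..m}. G j \<omega>) \<in> {1..m} \<rightarrow>\<^sub>E I} = space M"
      using mem[OF _ that] by blast
    ultimately show ?thesis by (simp add: emeasure_space_1)
  qed
  have S: "S \<subseteq> {1..n} \<rightarrow>\<^sub>E I" by (auto simp: S_def)
  have event: "{\<omega> \<in> space M. \<forall>a\<in>{1..r}. D n (w a) (\<lambda>j. G j \<omega>) \<ge> l a} =
    {\<omega> \<in> space M. (\<lambda>j\<in>{1..n}. G j \<omega>) \<in> S}"
  proof (rule Collect_cong, rule conj_cong[OF refl])
    fix \<omega> assume "\<omega> \<in> space M"
    define g where "g = (\<lambda>j\<in>{1..n}. G j \<omega>)"
    have g: "g \<in> {1..n} \<rightarrow>\<^sub>E I" unfolding g_def by (rule mem[OF \<open>\<omega> \<in> space M\<close> le_refl])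
    have "D n (w a) (\<lambda>j. G j \<omega>) = count (pasts n g) (cyc (v a))" if "a \<in> {1..r}" for a
      using D_eq_count[OF w(1,2)[OF that], of n g]
      unfolding g_def D_restrict v_def .
    then have "(\<forall>a\<in>{1..r}. D n (w a) (\<lambda>j. G j \<omega>) \<ge> l a) \<longleftrightarrow> B \<subseteq># pasts n g"
      unfolding B_def
      by (subst orbit_sum_subset_iff[OF _ v(1,2) nonconj tail_from_pasts]) simp_all
    also have "\<dots> \<longleftrightarrow> g \<in> S"
      using g bij_betw_apply[OF bij_betw_pasts g] by (simp add: S_def N_def)
    finally show "(\<forall>a\<in>{1..r}. D n (w a) (\<lambda>j. G j \<omega>) \<ge> l a) \<longleftrightarrow> (\<lambda>j\<in>{1..n}. G j \<omega>) \<in> S"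
      unfolding g_def .
  qed
  have bij: "bij_betw (pasts n) S N"
    unfolding S_def
    by (rule bij_betw_subset[OF bij_betw_pasts])
      (use bij_betw_imp_surj_on[OF bij_betw_pasts[of n I]] in \<open>auto simp: N_def\<close>)
  have "emeasure M {\<omega> \<in> space M. (\<lambda>j\<in>{1..n}. G j \<omega>) \<in> S} =
    (\<integral>\<^sup>+ L. ennreal (head_weight p L) \<partial>count_space N)"
    unfolding nn_integral_pasts[OF bij, symmetric]
    by (rule emeasure_tuple[OF assms(2,4,5) S])
  also have "\<dots> = (if size B \<le> n then head_weight p B else 0)"
  proof (cases "size B \<le> n")
    case True
    define m where "m = n - size B"
    \<comment> \<open>Adding \<open>B\<close> multiplies each weight by
      \<open>head_weight p B\<close>, and the weights on the remaining size \<open>m\<close> sum to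
      1 by \<open>total\<close>.\<close>
    have bij: "bij_betw (\<lambda>L. L + B) (necklaces I m) N"
      using bij_betw_add_necklaces[OF B, of m] True by (simp add: m_def N_def)
    have "(\<integral>\<^sup>+ L. ennreal (head_weight p L) \<partial>count_space N) =
      (\<integral>\<^sup>+ L. ennreal (head_weight p B) * ennreal (head_weight p L) \<partial>count_space (necklaces I m))"
      unfolding nn_integral_bij_count_space[OF bij, symmetric]
      by (intro nn_integral_cong)
        (simp add: weight_nonneg[OF B] weight_nonneg mult.commute flip: ennreal_mult)
    also have "\<dots> = ennreal (head_weight p B)"
      using total[of m] by (simp add: nn_integral_cmult m_def)
    finally show ?thesis using True by simp
  next
    case False
    then have "N = {}" by (auto simp: N_def necklaces_def dest: size_mset_mono)
    then show ?thesis using False by (simp add: nn_integral_empty)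
  qed
  finally show ?thesis
    unfolding event measure_def size_B weight_B[symmetric]
    using weight_nonneg[OF B] by simp
qed

end
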